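(* Consider the finite-horizon value functions $V_t^*$ of the BCR-SOC/MDP problem described in the context. Let Assumption A of the context hold, and suppose that for all $\xi_t\in\Xi$, $\mathcal C_t(s_t,a_t,\xi_t)$ and $g_t(s_t,a_t,\xi_t)$ are jointly convex in $(s_t,a_t)$ over $\mathcal S\times\mathcal A$ and non-decreasing in $s_t$ for each fixed $(a_t,\xi_t)$. If $\rho_{\mu_t}(\cdot)$ and $\rho_{P_{\theta_t}}(\cdot)$ are convex risk measures for $t=1,\dots,T$, then the following hold. (i) The problem $\inf_{a_t\in\mathcal A}\rho_{\mu_t}\circ\rho_{P_{\theta_t}}[\mathcal C_t(s_t,a_t,\xi_t)+\gamma V_{t+1}^*(s_{t+1},\mu_{t+1})]$ is a convex program (in $a_t$) for $t=1,\dots,T-1$. (ii) If, in addition, $\mathcal C_t(s_t,a_t,\xi_t)$ and $g_t(s_t,a_t,\xi_t)$ are Lipschitz continuous in $s_t\in\mathcal S$ uniformly for all $a_t$ and $\xi_t$, with moduli $L_{\mathcal C}$ and $L_g$ respectively, then $V_t^*(s_t,\mu_t)$ is Lipschitz continuous in $s_t$: $$|V_t^*(s_t^2,\mu_t)-V_t^*(s_t^1,\mu_t)|\le (L_{\mathcal C}+\gamma L_{V_{t+1}}L_g)\|s_t^1-s_t^2\|,\quad\forall s_t^1,s_t^2\in\mathcal S,\ t=1,\dots,T-1,$$ where $L_{V_t}=\sum_{i=0}^{T-t}(\gamma L_g)^iL_{\mathcal C}$. (iii) If, further, $\mathcal C_t(s_t,a_t,\xi_t)$ and $g_t(s_t,a_t,\xi_t)$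 are Lipschitz continuous in $a_t\in\mathcal A$ uniformly for all $s_t$ and $\xi_t$ (with the same moduli $L_{\mathcal C}$ and $L_g$), then $\mathcal C_t(s_t,a_t,\xi_t)+\gamma V_{t+1}^*(s_{t+1},\mu_{t+1})$ is Lipschitz continuous in $a_t$: $$\Big|\mathcal C_t(s_t,a_t^1,\xi_t)+\gamma V_{t+1}^*(g_t(s_t,a_t^1,\xi_t),\mu')-\mathcal C_t(s_t,a_t^2,\xi_t)-\gamma V_{t+1}^*(g_t(s_t,a_t^2,\xi_t),\mu')\Big|\le (L_{\mathcal C}+\gamma L_{V_{t+1}}L_g)\|a_t^1-a_t^2\|$$ for all $a_t^1,a_t^2\in\mathcal A$, $t=1,\dots,T-1$, where $\mu'$ is the Bayes update of $\mu_t$ given $\xi_t$.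
   Context: Risk measures: a map $\rho:L^p\to\mathbb R$ is a monetary risk measure if $X\ge Y$ pointwise implies $\rho(X)\ge\rho(Y)$ and $\rho(X+c)=\rho(X)+c$ for $c\in\mathbb R$; it is a convex risk measure if also $\rho(\lambda X+(1-\lambda)Y)\le\lambda\rho(X)+(1-\lambda)\rho(Y)$ for $\lambda\in[0,1]$; it is law invariant if $\rho(X)$ depends only on the distribution of $X$. Inner and outer risk measures are law invariant. $\mathcal M_1^{q}$ is the set of probability measures on $\mathbb R$ with finite $q$-th absolute moment. $\rho_{P_\theta}(Z(\xi))$ denotes the value of the inner risk measure at the law of $Z(\xi)$ when $\xi\sim P_\theta$; for a density $\mu$ on $\Theta\subseteq\mathbb R$, $\rho_\mu(Y(\theta))$ denotes the value of the outer risk measure at the law of $Y(\theta)$ when $\theta\sim\mu$; and $\rho_\mu\circ\rho_{P_\theta}(Z):=\rho_\mu\big(\theta\mapsto\rho_{P_\theta}(Z(\xi))\big)$. Model: $\mathcal S$ is the state space, $\mathcal A$ the action space, $\Xi$ the support of the $\xi_t$, $g_t:\mathcal S\times\mathcal A\times\Xi\to\mathcal S$ transition maps, $\mathcal C_t(s_t,a_t,\xi_t)$ ($t\le T-1$) and $\mathcal C_T(s_T)$ costs, $\gamma\in(0,1]$. $\mathcal D_1^p$ is the set of densities on $\Theta$ whose distributions lie in $\mathcal M_1^p$. $s_{t+1}=g_t(s_t,a_t,\xi_t)$ and the Bayes update is $\mu_{t+1}(\theta)=\frac{p(\xi_t|\theta)\mu_t(\theta)}{\int_\Theta p(\xi_t|\theta)\mu_t(\theta)\,d\theta}$,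 where $p(\cdot|\theta)$ is the density of $P_\theta$; $\theta_t$ has density $\mu_t$. Value functions on $\mathcal S\times\mathcal D_1^p$: $V_T^*(s_T,\mu_T)=\mathcal C_T(s_T)$ and, for $t=T-1,\dots,1$, $V_t^*(s_t,\mu_t)=\inf_{a_t\in\mathcal A}\rho_{\mu_t}\circ\rho_{P_{\theta_t}}[\mathcal C_t(s_t,a_t,\xi_t)+\gamma V_{t+1}^*(s_{t+1},\mu_{t+1})]$. Assumption A: (a) Each $\mathcal C_t$ is continuous, and for some positive constants $\kappa_{\mathcal C},\upsilon$: $|\mathcal C_t(s_t,a_t,\xi_t)|\le \kappa_{\mathcal C}(|\xi_t|^{\upsilon}+1)$ for all arguments, $t=1,\dots,T-1$, and $|\mathcal C_T(g_{T-1}(s_{T-1},a_{T-1},\xi_{T-1}))|\le \kappa_{\mathcal C}(|\xi_{T-1}|^{\upsilon}+1)$ for all arguments. (b) For $t=1,\dots,T-1$, $\rho_{P_{\theta_t}}:L^{\upsilon}\to\mathbb R$ is a continuous law invariant monetary risk measure with $\rho_{P_{\theta_t}}(|\xi_t|^{\upsilon})<\infty$ for all $\theta_t\in\Theta$, and $\rho_{\mu_t}\circ\rho_{P_{\theta_t}}(|\xi_t|^{\upsilon})\le \kappa_\rho(|\xi_{t-1}|^{\upsilon}+1)$ with a positive constant $\kappa_\rho$ depending on $t$ ($\xi_0$ a fixed constant). (c) $\xi_1,\dots,\xi_T$ are i.i.d. with true unknown distribution $P_{\theta^c}$ belonging to a parametric family $\{P_\theta:\theta\in\Theta\}$, $P_\theta\in\mathcal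 M_1^{\upsilon p}$ for all $\theta$. (d) $p(\xi|\theta)$ is continuous in $\theta$ over $\Theta\subset\mathbb R$. (e) $\mathcal A$ is compact and convex. *)

theory Defs
  imports "HOL-Probability.Probability"
begin

section \<open>Risk measures\<close>

definition Lq :: "'w measure \<Rightarrow> real \<Rightarrow> ('w \<Rightarrow> real) set" where
  "Lq \<Omega> q = {X \<in> borel_measurable \<Omega>. integrable \<Omega> (\<lambda>\<omega>. \<bar>X \<omega>\<bar> powr q)}"

definition M1 :: "real \<Rightarrow> real measure set" where
  "M1 q = {Q. prob_space Q \<and> sets Q = sets borel \<and> integrable Q (\<lambda>x. \<bar>x\<bar> powr q)}"

definition monetary_risk_measure ::
  "'w measure \<Rightarrow> real \<Rightarrow> (('w \<Rightarrow> real) \<Rightarrow> real) \<Rightarrow> bool" where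
  "monetary_risk_measure \<Omega> q \<rho> \<longleftrightarrow>
     (\<forall>X\<in>Lq \<Omega> q. \<forall>Y\<in>Lq \<Omega> q. (\<forall>\<omega>\<in>space \<Omega>. X \<omega> \<ge> Y \<omega>) \<longrightarrow> \<rho> X \<ge> \<rho> Y) \<and>
     (\<forall>X\<in>Lq \<Omega> q. \<forall>c::real. \<rho> (\<lambda>\<omega>. X \<omega> + c) = \<rho> X + c)"

definition convex_risk_measure ::
  "'w measure \<Rightarrow> real \<Rightarrow> (('w \<Rightarrow> real) \<Rightarrow> real) \<Rightarrow> bool" where
  "convex_risk_measure \<Omega> q \<rho> \<longleftrightarrow>
     monetary_risk_measure \<Omega> q \<rho> \<and>
     (\<forall>X\<in>Lq \<Omega> q. \<forall>Y\<in>Lq \<Omega> q. \<forall>l\<in>{0..1::real}.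
        \<rho> (\<lambda>\<omega>. l * X \<omega> + (1 - l) * Y \<omega>) \<le> l * \<rho> X + (1 - l) * \<rho> Y)"

definition law_invariant ::
  "'w measure \<Rightarrow> real \<Rightarrow> (('w \<Rightarrow> real) \<Rightarrow> real) \<Rightarrow> bool" where
  "law_invariant \<Omega> q \<rho> \<longleftrightarrow>
     (\<forall>X\<in>Lq \<Omega> q. \<forall>Y\<in>Lq \<Omega> q. distr \<Omega> borel X = distr \<Omega> borel Y \<longrightarrow> \<rho> X = \<rho> Y)"

text \<open>Continuity is stated through \<open>E \<bar>X\<^sub>n - X\<bar>\<^sup>q \<longlonglongrightarrow> 0\<close>,
  which is convergence in the \<open>L\<^sup>q\<close> norm if \<open>q \<ge> 1\<close> and also makes sense for \<open>0 < q < 1\<close>.\<close>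

definition Lq_continuous ::
  "'w measure \<Rightarrow> real \<Rightarrow> (('w \<Rightarrow> real) \<Rightarrow> real) \<Rightarrow> bool" where
  "Lq_continuous \<Omega> q \<rho> \<longleftrightarrow>
     (\<forall>Xs X. (\<forall>n::nat. Xs n \<in> Lq \<Omega> q) \<and> X \<in> Lq \<Omega> q \<and>
        (\<lambda>n. \<integral>\<omega>. \<bar>Xs n \<omega> - X \<omega>\<bar> powr q \<partial>\<Omega>) \<longlonglongrightarrow> 0
        \<longrightarrow> (\<lambda>n. \<rho> (Xs n)) \<longlonglongrightarrow> \<rho> X)"

text \<open>The base space of the risk measures has to carry every law on the real line (equivalently,
  it is atomless); otherwise the value of a law invariant risk measure at a given law need not
  be defined.\<close>

definition carries_all_laws :: "'w measure \<Rightarrow> bool" where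
  "carries_all_laws \<Omega> \<longleftrightarrow>
     (\<forall>Q::real measure. prob_space Q \<and> sets Q = sets borel \<longrightarrow>
        (\<exists>X\<in>borel_measurable \<Omega>. distr \<Omega> borel X = Q))"

text \<open>The value of \<open>\<rho>\<close> at the law \<open>Q\<close>. For law invariant \<open>\<rho>\<close> it does not depend on the
  chosen representative; it is meaningful for \<open>Q \<in> M1 q\<close> only.\<close>

definition at_law ::
  "'w measure \<Rightarrow> real \<Rightarrow> (('w \<Rightarrow> real) \<Rightarrow> real) \<Rightarrow> real measure \<Rightarrow> real" where
  "at_law \<Omega> q \<rho> Q = \<rho> (SOME X. X \<in> Lq \<Omega> q \<and> distr \<Omega> borel X = Q)"


section \<open>The model\<close>

text \<open>\<open>lik M \<xi> \<theta>\<close> is the density $p(\xi|\theta)$. All functions are total; their values outside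
  \<open>states\<close>, \<open>actions\<close>, \<open>noise\<close>, \<open>params\<close> and the time range are irrelevant.
  \<open>inner_exp\<close> and \<open>outer_exp\<close> are the exponents of the domains
  $L^\upsilon$ and $L^p$ of the inner and the outer risk measures.\<close>

record ('w, 's, 'a) bcr =
  horizon :: nat
  states :: "'s set"
  actions :: "'a set"
  noise :: "real set"
  params :: "real set"
  lik :: "real \<Rightarrow> real \<Rightarrow> real"
  trans :: "nat \<Rightarrow> 's \<Rightarrow> 'a \<Rightarrow> real \<Rightarrow> 's"
  cost :: "nat \<Rightarrow> 's \<Rightarrow> 'a \<Rightarrow> real \<Rightarrow> real"
  final_cost :: "'s \<Rightarrow> real"
  disc :: real
  base :: "'w measure"
  inner_rm :: "nat \<Rightarrow> ('w \<Rightarrow> real) \<Rightarrow> real"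
  outer_rm :: "nat \<Rightarrow> ('w \<Rightarrow> real) \<Rightarrow> real"
  inner_exp :: real
  outer_exp :: real

definition obs_law :: "('w, 's, 'a) bcr \<Rightarrow> real \<Rightarrow> real measure" where
  "obs_law M \<theta> = density (restrict_space lborel (noise M)) (\<lambda>\<xi>. ennreal (lik M \<xi> \<theta>))"

definition belief_law :: "('w, 's, 'a) bcr \<Rightarrow> (real \<Rightarrow> real) \<Rightarrow> real measure" where
  "belief_law M \<mu> = density (restrict_space lborel (params M)) (\<lambda>\<theta>. ennreal (\<mu> \<theta>))"

definition beliefs :: "('w, 's, 'a) bcr \<Rightarrow> (real \<Rightarrow> real) set" where
  "beliefs M = {\<mu>. \<mu> \<in> borel_measurable (restrict_space lborel (params M)) \<and>
     (\<forall>\<theta>\<in>params M. 0 \<le> \<mu> \<theta>) \<and>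
     distr (belief_law M \<mu>) borel (\<lambda>\<theta>. \<theta>) \<in> M1 (outer_exp M)}"

text \<open>If the normalising integral is zero or infinite, the result is the zero function, which is
  not in \<open>beliefs M\<close>.\<close>

definition bayes :: "('w, 's, 'a) bcr \<Rightarrow> (real \<Rightarrow> real) \<Rightarrow> real \<Rightarrow> real \<Rightarrow> real" where
  "bayes M \<mu> \<xi> = (\<lambda>\<theta>. lik M \<xi> \<theta> * \<mu> \<theta> / (LINT \<theta>':params M|lborel. lik M \<xi> \<theta>' * \<mu> \<theta>'))"

definition inner_val :: "('w, 's, 'a) bcr \<Rightarrow> nat \<Rightarrow> (real \<Rightarrow> real) \<Rightarrow> real \<Rightarrow> real" where
  "inner_val M t Z \<theta> =
     at_law (base M) (inner_exp M) (inner_rm M t) (distr (obs_law M \<theta>) borel Z)"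

definition composite ::
  "('w, 's, 'a) bcr \<Rightarrow> nat \<Rightarrow> (real \<Rightarrow> real) \<Rightarrow> (real \<Rightarrow> real) \<Rightarrow> real" where
  "composite M t \<mu> Z =
     at_law (base M) (outer_exp M) (outer_rm M t) (distr (belief_law M \<mu>) borel (inner_val M t Z))"

text \<open>\<open>Z(\<xi>)\<close> lies in the domain of the composite risk measure.\<close>

definition composable ::
  "('w, 's, 'a) bcr \<Rightarrow> nat \<Rightarrow> (real \<Rightarrow> real) \<Rightarrow> (real \<Rightarrow> real) \<Rightarrow> bool" where
  "composable M t \<mu> Z \<longleftrightarrow>
     (\<forall>\<theta>\<in>params M. Z \<in> Lq (obs_law M \<theta>) (inner_exp M)) \<and>
     inner_val M t Z \<in> Lq (belief_law M \<mu>) (outer_exp M)"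

text \<open>Backward recursion by the number of remaining stages. The value functions are functions on
  \<open>states M \<times> beliefs M\<close>; before the final stage they are extended by \<open>0\<close> to densities outside
  \<open>beliefs M\<close>. This does not affect the values on \<open>beliefs M\<close>: for \<open>\<mu> \<in> beliefs M\<close> the observations
  \<open>\<xi>\<close> with \<open>bayes M \<mu> \<xi> \<notin> beliefs M\<close> form a null set of \<open>obs_law M \<theta>\<close> for almost
  every \<open>\<theta>\<close> under \<open>belief_law M \<mu>\<close>.\<close>

primrec value_togo ::
  "('w, 's, 'a) bcr \<Rightarrow> nat \<Rightarrow> 's \<Rightarrow> (real \<Rightarrow> real) \<Rightarrow> real" where
  "value_togo M 0 = (\<lambda>s \<mu>. final_cost M s)"
| "value_togo M (Suc n) = (\<lambda>s \<mu>.
     if \<mu> \<in> beliefs M then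
       (INF a\<in>actions M. composite M (horizon M - Suc n) \<mu>
          (\<lambda>\<xi>. cost M (horizon M - Suc n) s a \<xi> +
             disc M * value_togo M n (trans M (horizon M - Suc n) s a \<xi>) (bayes M \<mu> \<xi>)))
     else 0)"

definition value_fun ::
  "('w, 's, 'a) bcr \<Rightarrow> nat \<Rightarrow> 's \<Rightarrow> (real \<Rightarrow> real) \<Rightarrow> real" where
  "value_fun M t = value_togo M (horizon M - t)"

definition stage_cost ::
  "('w, 's, 'a) bcr \<Rightarrow> nat \<Rightarrow> 's \<Rightarrow> 'a \<Rightarrow> (real \<Rightarrow> real) \<Rightarrow> real \<Rightarrow> real" where
  "stage_cost M t s a \<mu> \<xi> =
     cost M t s a \<xi> + disc M * value_fun M (t + 1) (trans M t s a \<xi>) (bayes M \<mu> \<xi>)"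

lemma value_fun_final: "value_fun M (horizon M) s \<mu> = final_cost M s"
  by (simp add: value_fun_def)

lemma value_fun_bellman:
  assumes "t < horizon M" and "\<mu> \<in> beliefs M"
  shows "value_fun M t s \<mu> = (INF a\<in>actions M. composite M t \<mu> (stage_cost M t s a \<mu>))"
proof -
  have "horizon M - t = Suc (horizon M - (t + 1))" "horizon M - Suc (horizon M - (t + 1)) = t"
    using assms(1) by auto
  then show ?thesis
    using assms(2) by (simp add: value_fun_def stage_cost_def [abs_def])
qed


section \<open>Assumptions\<close>

definition bcr_model ::
  "('w, 's :: ordered_euclidean_space, 'a :: euclidean_space) bcr \<Rightarrow> bool" where
  "bcr_model M \<longleftrightarrow>
     1 \<le> horizon M \<and> 0 < disc M \<and> disc M \<le> 1 \<and> 1 \<le> outer_exp M \<and> 0 < inner_exp M \<and>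
     actions M \<noteq> {} \<and>
     (\<forall>t\<in>{1..horizon M - 1}. \<forall>s\<in>states M. \<forall>a\<in>actions M. \<forall>\<xi>\<in>noise M.
        trans M t s a \<xi> \<in> states M) \<and>
     noise M \<in> sets borel \<and> params M \<in> sets borel \<and>
     (\<forall>\<theta>\<in>params M. (\<lambda>\<xi>. lik M \<xi> \<theta>) \<in> borel_measurable (restrict_space lborel (noise M)) \<and>
        (\<forall>\<xi>\<in>noise M. 0 \<le> lik M \<xi> \<theta>) \<and> prob_space (obs_law M \<theta>)) \<and>
     prob_space (base M) \<and> carries_all_laws (base M) \<and>
     (\<forall>t\<in>{1..horizon M}. law_invariant (base M) (inner_exp M) (inner_rm M t) \<and>
        law_invariant (base M) (outer_exp M) (outer_rm M t))"

text \<open>The measurability and integrability that the Bellman recursion tacitly presupposes: every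
  cost-to-go to which the composite risk measure is applied lies in its domain.\<close>

definition value_fun_well_defined :: "('w, 's, 'a) bcr \<Rightarrow> bool" where
  "value_fun_well_defined M \<longleftrightarrow>
     (\<forall>t\<in>{1..horizon M - 1}. \<forall>s\<in>states M. \<forall>a\<in>actions M. \<forall>\<mu>\<in>beliefs M.
        composable M t \<mu> (stage_cost M t s a \<mu>))"

text \<open>\<open>posterior M \<mu> x n\<close> is the belief obtained from \<open>\<mu>\<close> after observing \<open>x 1, \<dots>, x n\<close>, so
  $\mu_t$ is \<open>posterior M \<mu>\<^sub>1 x (t - 1)\<close>.\<close>

primrec posterior ::
  "('w, 's, 'a) bcr \<Rightarrow> (real \<Rightarrow> real) \<Rightarrow> (nat \<Rightarrow> real) \<Rightarrow> nat \<Rightarrow> real \<Rightarrow> real" where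
  "posterior M \<mu> x 0 = \<mu>"
| "posterior M \<mu> x (Suc n) = bayes M (posterior M \<mu> x n) (x (Suc n))"

definition cost_growth :: "('w, 's :: topological_space, 'a :: topological_space) bcr \<Rightarrow> real \<Rightarrow> bool"
  where
  "cost_growth M \<kappa> \<longleftrightarrow>
     0 < \<kappa> \<and>
     (\<forall>t\<in>{1..horizon M - 1}.
        continuous_on (states M \<times> actions M \<times> noise M) (\<lambda>(s, a, \<xi>). cost M t s a \<xi>)) \<and>
     continuous_on (states M) (final_cost M) \<and>
     (\<forall>t\<in>{1..horizon M - 1}. \<forall>s\<in>states M. \<forall>a\<in>actions M. \<forall>\<xi>\<in>noise M.
        \<bar>cost M t s a \<xi>\<bar> \<le> \<kappa> * (\<bar>\<xi>\<bar> powr inner_exp M + 1)) \<and>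
     (1 < horizon M \<longrightarrow> (\<forall>s\<in>states M. \<forall>a\<in>actions M. \<forall>\<xi>\<in>noise M.
        \<bar>final_cost M (trans M (horizon M - 1) s a \<xi>)\<bar> \<le> \<kappa> * (\<bar>\<xi>\<bar> powr inner_exp M + 1)))"

text \<open>Finiteness of the inner risk of $|\xi_t|^\upsilon$ means that $|\xi_t|^\upsilon$ belongs to
  the domain $L^\upsilon$ of the real-valued inner risk measure. The bound on the composite risk is
  required along the posteriors of the prior \<open>\<mu>\<^sub>1\<close>; \<open>x 0\<close> is the constant \<open>\<xi>\<^sub>0\<close>.\<close>

definition risk_growth ::
  "('w, 's, 'a) bcr \<Rightarrow> (nat \<Rightarrow> real) \<Rightarrow> real \<Rightarrow> (real \<Rightarrow> real) \<Rightarrow> bool" where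
  "risk_growth M \<kappa>\<^sub>\<rho> \<xi>\<^sub>0 \<mu>\<^sub>1 \<longleftrightarrow>
     \<mu>\<^sub>1 \<in> beliefs M \<and>
     (\<forall>t\<in>{1..horizon M - 1}.
        monetary_risk_measure (base M) (inner_exp M) (inner_rm M t) \<and>
        law_invariant (base M) (inner_exp M) (inner_rm M t) \<and>
        Lq_continuous (base M) (inner_exp M) (inner_rm M t) \<and>
        (\<forall>\<theta>\<in>params M. (\<lambda>\<xi>. \<bar>\<xi>\<bar> powr inner_exp M) \<in> Lq (obs_law M \<theta>) (inner_exp M)) \<and>
        0 < \<kappa>\<^sub>\<rho> t \<and>
        (\<forall>x. x 0 = \<xi>\<^sub>0 \<and> (\<forall>i\<in>{1..<t}. x i \<in> noise M) \<and> posterior M \<mu>\<^sub>1 x (t - 1) \<in> beliefs M \<longrightarrow>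
           composable M t (posterior M \<mu>\<^sub>1 x (t - 1)) (\<lambda>\<xi>. \<bar>\<xi>\<bar> powr inner_exp M) \<and>
           composite M t (posterior M \<mu>\<^sub>1 x (t - 1)) (\<lambda>\<xi>. \<bar>\<xi>\<bar> powr inner_exp M)
             \<le> \<kappa>\<^sub>\<rho> t * (\<bar>x (t - 1)\<bar> powr inner_exp M + 1)))"

definition observations_iid ::
  "('w, 's, 'a) bcr \<Rightarrow> 'v measure \<Rightarrow> (nat \<Rightarrow> 'v \<Rightarrow> real) \<Rightarrow> real \<Rightarrow> bool" where
  "observations_iid M N \<xi> \<theta>\<^sub>c \<longleftrightarrow>
     prob_space N \<and> \<theta>\<^sub>c \<in> params M \<and>
     prob_space.indep_vars N (\<lambda>_. restrict_space borel (noise M)) \<xi> {1..horizon M} \<and>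
     (\<forall>t\<in>{1..horizon M}. distr N (restrict_space borel (noise M)) (\<xi> t) = obs_law M \<theta>\<^sub>c) \<and>
     (\<forall>\<theta>\<in>params M. distr (obs_law M \<theta>) borel (\<lambda>x. x) \<in> M1 (inner_exp M * outer_exp M))"

definition assumption_A ::
  "('w, 's :: ordered_euclidean_space, 'a :: euclidean_space) bcr \<Rightarrow> real \<Rightarrow> (nat \<Rightarrow> real) \<Rightarrow> real \<Rightarrow>
     (real \<Rightarrow> real) \<Rightarrow> 'v measure \<Rightarrow> (nat \<Rightarrow> 'v \<Rightarrow> real) \<Rightarrow> real \<Rightarrow> bool" where
  "assumption_A M \<kappa>\<^sub>C \<kappa>\<^sub>\<rho> \<xi>\<^sub>0 \<mu>\<^sub>1 N \<xi> \<theta>\<^sub>c \<longleftrightarrow>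
     cost_growth M \<kappa>\<^sub>C \<and>
     risk_growth M \<kappa>\<^sub>\<rho> \<xi>\<^sub>0 \<mu>\<^sub>1 \<and>
     observations_iid M N \<xi> \<theta>\<^sub>c \<and>
     (\<forall>x\<in>noise M. continuous_on (params M) (\<lambda>\<theta>. lik M x \<theta>)) \<and>
     compact (actions M) \<and> convex (actions M)"

text \<open>Convexity of vector-valued maps with respect to the componentwise order.\<close>

definition order_convex_on ::
  "'x :: real_vector set \<Rightarrow> ('x \<Rightarrow> 'y :: ordered_real_vector) \<Rightarrow> bool" where
  "order_convex_on X f \<longleftrightarrow>
     convex X \<and>
     (\<forall>x\<in>X. \<forall>y\<in>X. \<forall>u\<ge>0. \<forall>v\<ge>0. u + v = 1 \<longrightarrow>
        f (u *\<^sub>R x + v *\<^sub>R y) \<le> u *\<^sub>R f x + v *\<^sub>R f y)"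

definition value_lipschitz_const :: "('w, 's, 'a) bcr \<Rightarrow> real \<Rightarrow> real \<Rightarrow> nat \<Rightarrow> real" where
  "value_lipschitz_const M L\<^sub>C L\<^sub>g t = (\<Sum>i=0..horizon M - t. (disc M * L\<^sub>g) ^ i * L\<^sub>C)"

end

theory Submission
  imports Defs
begin

text \<open>
  \<^bold>\<open>Risk measures as functionals of random variables.\<close> The composite risk measure evaluates its two
  layers at laws, while convexity and monotonicity compare random variables pointwise. The two
  views are reconciled by realization: the base space carries a random element \<open>U\<close> whose law is the
  observation law (or the belief), and the value at the law of \<open>X(\<xi>)\<close> is the risk of \<open>X \<circ> U\<close>.
  Since all functions of \<open>\<xi>\<close> are composed with the same \<open>U\<close>, monotonicity, translation and convexity
  pass to the functional on functions of \<open>\<xi>\<close> (\<open>convex_risk_measure_at_law\<close>). Applied to the inner and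
  then to the outer layer this gives \<open>composite_le\<close>: a pointwise bound of one cost by a convex
  combination of two others plus a constant is inherited by the composite risks.

  \<^bold>\<open>Convexity.\<close> By backward induction in time, every \<open>value_fun M t \<sqdot> \<mu>\<close> is convex and
  non-decreasing in the state. If this holds at \<open>t + 1\<close>, the cost-to-go at \<open>t\<close> is, for each
  observation, jointly convex in state and action, because a convex non-decreasing function of an
  order convex map is convex; \<open>composite_le\<close> transfers this to the composite risk, and minimization
  over the action preserves joint convexity (\<open>convex_on_INF\<close>) and monotonicity.

  The infimum of a set of reals that is unbounded below is a meaningless default value, so each
  minimization needs a lower bound of the composite risk over the actions, at every belief and not
  only at the posteriors of one prior. It comes from convexity: a finite convex function on a
  bounded convex subset of a Euclidean space is bounded below
  (\<open>convex_on_bounded_imp_bdd_below\<close>).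

  \<^bold>\<open>Lipschitz continuity.\<close> If the value function at \<open>t + 1\<close> is \<open>L\<close>-Lipschitz in the state, the
  cost-to-go at \<open>t\<close> is Lipschitz with modulus \<open>L\<^sub>C + \<gamma> L L\<^sub>g\<close>, uniformly in the observation. By
  \<open>composite_le\<close> the composite risk moves by at most the same amount, uniformly in the action, and so does
  its infimum. The moduli form a geometric sum. Lipschitz continuity in the action is the same
  composition estimate in the other variable.
\<close>

section \<open>Risk measures evaluated at laws\<close>

lemma const_in_Lq:
  assumes "prob_space Q"
  shows "(\<lambda>_. c) \<in> Lq Q q"
proof -
  interpret prob_space Q by fact
  show ?thesis by (simp add: Lq_def)
qed

lemma scale_in_Lq:
  assumes "X \<in> Lq Q q"
  shows "(\<lambda>\<omega>. c * X \<omega>) \<in> Lq Q q"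
  using assms by (auto simp: Lq_def abs_mult powr_mult)

lemma add_in_Lq:
  assumes "0 \<le> q" "X \<in> Lq Q q" "Y \<in> Lq Q q"
  shows "(\<lambda>\<omega>. X \<omega> + Y \<omega>) \<in> Lq Q q"
proof -
  have [measurable]: "X \<in> borel_measurable Q" "Y \<in> borel_measurable Q"
    using assms by (auto simp: Lq_def)
  have bound: "\<bar>x + y\<bar> powr q \<le> 2 powr q * (\<bar>x\<bar> powr q + \<bar>y\<bar> powr q)" for x y :: real
  proof -
    have "\<bar>x + y\<bar> powr q \<le> (2 * max \<bar>x\<bar> \<bar>y\<bar>) powr q"
      using assms(1) by (intro powr_mono2) auto
    also have "\<dots> = 2 powr q * max \<bar>x\<bar> \<bar>y\<bar> powr q"
      by (simp add: powr_mult)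
    also have "\<dots> \<le> 2 powr q * (\<bar>x\<bar> powr q + \<bar>y\<bar> powr q)"
      by (intro mult_left_mono) (auto simp: max_def)
    finally show ?thesis .
  qed
  have "integrable Q (\<lambda>\<omega>. 2 powr q * (\<bar>X \<omega>\<bar> powr q + \<bar>Y \<omega>\<bar> powr q))"
    using assms by (auto simp: Lq_def)
  then have "integrable Q (\<lambda>\<omega>. \<bar>X \<omega> + Y \<omega>\<bar> powr q)"
    by (rule Bochner_Integration.integrable_bound) (auto simp: bound)
  then show ?thesis by (simp add: Lq_def)
qed

text \<open>Convexity, monotonicity and translation in a single estimate: with \<open>c = 0\<close> it gives convexity
  of compositions, with \<open>l = 1\<close> it gives monotonicity and Lipschitz bounds. The risk of \<open>V\<close> is compared
  with the risks of \<open>X\<close> and \<open>Y\<close> only, so that in the two-layer situation nothing has to be known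
  about the inner risk of the combination of \<open>X\<close> and \<open>Y\<close>.\<close>

lemma convex_risk_measure_le:
  assumes R: "convex_risk_measure Q q R" and Q: "prob_space Q" and q: "0 \<le> q"
    and V: "V \<in> Lq Q q" and X: "X \<in> Lq Q q" and Y: "Y \<in> Lq Q q" and l: "l \<in> {0..1}"
    and le: "\<And>\<omega>. \<omega> \<in> space Q \<Longrightarrow> V \<omega> \<le> l * X \<omega> + (1 - l) * Y \<omega> + c"
  shows "R V \<le> l * R X + (1 - l) * R Y + c"
proof -
  have comb: "(\<lambda>\<omega>. l * X \<omega> + (1 - l) * Y \<omega>) \<in> Lq Q q"
    by (intro add_in_Lq scale_in_Lq q X Y)
  have "R V \<le> R (\<lambda>\<omega>. (l * X \<omega> + (1 - l) * Y \<omega>) + c)"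
    using R V le add_in_Lq[OF q comb const_in_Lq[OF Q, of c]]
    by (auto simp: convex_risk_measure_def monetary_risk_measure_def)
  also have "\<dots> = R (\<lambda>\<omega>. l * X \<omega> + (1 - l) * Y \<omega>) + c"
    using R comb by (auto simp: convex_risk_measure_def monetary_risk_measure_def)
  also have "\<dots> \<le> l * R X + (1 - l) * R Y + c"
    using R X Y l by (auto simp: convex_risk_measure_def)
  finally show ?thesis .
qed

text \<open>The base space carries the law of \<open>Q\<close> extended to the whole line. The realization takes values
  in \<open>S\<close> almost surely; moving the exceptional null set to one point of \<open>S\<close> makes it take values
  in \<open>S\<close> everywhere, so that pointwise inequalities on \<open>S\<close> become pointwise inequalities on \<open>\<Omega>\<close>.\<close>

lemma carries_all_laws_realize:
  fixes Q :: "real measure"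
  assumes \<Omega>: "carries_all_laws \<Omega>" and Q: "prob_space Q"
    and S: "S \<in> sets borel" and sets: "sets Q = sets (restrict_space borel S)"
  obtains U where "U \<in> measurable \<Omega> Q" "distr \<Omega> Q U = Q"
proof -
  interpret prob_space Q by fact
  have sp: "space Q = S"
    using sets_eq_imp_space_eq[OF sets] by (simp add: space_restrict_space)
  have id: "(\<lambda>x. x) \<in> measurable Q borel"
    by (subst measurable_cong_sets[OF sets refl]) (rule measurable_restrict_space1, simp)
  have "prob_space (distr Q borel (\<lambda>x. x))"
    by (rule prob_space_distr[OF id])
  then obtain U where U [measurable]: "U \<in> borel_measurable \<Omega>"
    and dU: "distr \<Omega> borel U = distr Q borel (\<lambda>x. x)"
    using \<Omega> by (force simp: carries_all_laws_def)
  obtain s where s: "s \<in> S" using not_empty sp by auto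
  define U' where "U' \<omega> = (if U \<omega> \<in> S then U \<omega> else s)" for \<omega>
  have [measurable]: "S \<in> sets borel" by fact
  have U'b: "U' \<in> borel_measurable \<Omega>"
    unfolding U'_def by measurable
  have U': "U' \<in> measurable \<Omega> Q"
    by (subst measurable_cong_sets[OF refl sets])
      (use s U'b in \<open>auto intro!: measurable_restrict_space2 simp: U'_def\<close>)
  have "AE x in distr Q borel (\<lambda>x. x). x \<in> S"
    by (subst AE_distr_iff[OF id]) (use sp in auto)
  then have "AE x in distr \<Omega> borel U. x \<in> S"
    unfolding dU .
  then have ae: "AE \<omega> in \<Omega>. U' \<omega> = U \<omega>"
    by (subst (asm) AE_distr_iff) (auto simp: U'_def)
  have "distr \<Omega> Q U' = Q"
  proof (rule measure_eqI)
    fix A assume "A \<in> sets (distr \<Omega> Q U')"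
    then have A: "A \<in> sets Q" by simp
    then have AS: "A \<subseteq> S" "A \<in> sets borel"
      using S by (auto simp: sets sets_restrict_space_iff)
    have "emeasure (distr \<Omega> Q U') A = emeasure \<Omega> (U' -` A \<inter> space \<Omega>)"
      by (rule emeasure_distr[OF U' A])
    also have "\<dots> = emeasure \<Omega> (U -` A \<inter> space \<Omega>)"
      using ae U'b U AS by (intro emeasure_eq_AE) (auto intro: measurable_sets)
    also have "\<dots> = emeasure (distr \<Omega> borel U) A"
      using AS by (simp add: emeasure_distr)
    also have "\<dots> = emeasure Q A"
      unfolding dU using AS sp by (subst emeasure_distr[OF id]) (auto simp: Int_absorb2)
    finally show "emeasure (distr \<Omega> Q U') A = emeasure Q A" .
  qed simp
  with U' show ?thesis by (rule that)
qed

text \<open>Law invariance allows each representative in the definition of \<open>at_law\<close> to be replaced by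
  \<open>X \<circ> U\<close> with one common \<open>U\<close>. Precomposition with \<open>U\<close> preserves order, constants and convex
  combinations.\<close>

lemma convex_risk_measure_at_law:
  fixes Q :: "real measure"
  assumes \<rho>: "convex_risk_measure \<Omega> q \<rho>" and inv: "law_invariant \<Omega> q \<rho>"
    and \<Omega>: "carries_all_laws \<Omega>" and q: "0 \<le> q" and Q: "prob_space Q"
    and S: "S \<in> sets borel" and sets: "sets Q = sets (restrict_space borel S)"
  shows "convex_risk_measure Q q (\<lambda>X. at_law \<Omega> q \<rho> (distr Q borel X))"
proof -
  obtain U where U: "U \<in> measurable \<Omega> Q" and dU: "distr \<Omega> Q U = Q"
    using carries_all_laws_realize[OF \<Omega> Q S sets] .
  have LqU: "(\<lambda>\<omega>. X (U \<omega>)) \<in> Lq \<Omega> q" if "X \<in> Lq Q q" for X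
  proof -
    from that have X: "X \<in> borel_measurable Q" and int: "integrable Q (\<lambda>x. \<bar>X x\<bar> powr q)"
      by (auto simp: Lq_def)
    from int have "integrable (distr \<Omega> Q U) (\<lambda>x. \<bar>X x\<bar> powr q)"
      by (simp only: dU)
    then have "integrable \<Omega> (\<lambda>\<omega>. \<bar>X (U \<omega>)\<bar> powr q)"
      by (rule integrable_distr[OF U])
    then show ?thesis using measurable_compose[OF U X] by (simp add: Lq_def)
  qed
  have val: "at_law \<Omega> q \<rho> (distr Q borel X) = \<rho> (\<lambda>\<omega>. X (U \<omega>))" if "X \<in> Lq Q q" for X
  proof -
    have X: "X \<in> borel_measurable Q" using that by (simp add: Lq_def)
    have law: "distr \<Omega> borel (\<lambda>\<omega>. X (U \<omega>)) = distr Q borel X"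
      using distr_distr[OF X U] by (simp add: dU comp_def)
    let ?Y = "SOME Y. Y \<in> Lq \<Omega> q \<and> distr \<Omega> borel Y = distr Q borel X"
    have "?Y \<in> Lq \<Omega> q \<and> distr \<Omega> borel ?Y = distr Q borel X"
      by (rule someI[of _ "\<lambda>\<omega>. X (U \<omega>)"]) (simp add: law LqU that)
    then show ?thesis
      using inv LqU[OF that] law unfolding law_invariant_def at_law_def by metis
  qed
  have Uspace: "U \<omega> \<in> space Q" if "\<omega> \<in> space \<Omega>" for \<omega>
    using measurable_space[OF U that] .
  show ?thesis
    unfolding convex_risk_measure_def monetary_risk_measure_def
  proof (intro conjI ballI allI impI)
    fix X Y assume XY: "X \<in> Lq Q q" "Y \<in> Lq Q q" "\<forall>\<omega>\<in>space Q. Y \<omega> \<le> X \<omega>"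
    then show "at_law \<Omega> q \<rho> (distr Q borel Y) \<le> at_law \<Omega> q \<rho> (distr Q borel X)"
      using \<rho> LqU[of X] LqU[of Y] Uspace
      by (auto simp: val convex_risk_measure_def monetary_risk_measure_def)
  next
    fix X c assume X: "X \<in> Lq Q q"
    then have "(\<lambda>\<omega>. X \<omega> + c) \<in> Lq Q q"
      by (intro add_in_Lq q const_in_Lq Q)
    then show "at_law \<Omega> q \<rho> (distr Q borel (\<lambda>\<omega>. X \<omega> + c)) = at_law \<Omega> q \<rho> (distr Q borel X) + c"
      using \<rho> LqU[OF X] X by (auto simp: val convex_risk_measure_def monetary_risk_measure_def)
  next
    fix X Y and l :: real assume XY: "X \<in> Lq Q q" "Y \<in> Lq Q q" and l: "l \<in> {0..1}"
    then have "(\<lambda>\<omega>. l * X \<omega> + (1 - l) * Y \<omega>) \<in> Lq Q q"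
      by (intro add_in_Lq scale_in_Lq q)
    then show "at_law \<Omega> q \<rho> (distr Q borel (\<lambda>\<omega>. l * X \<omega> + (1 - l) * Y \<omega>))
        \<le> l * at_law \<Omega> q \<rho> (distr Q borel X) + (1 - l) * at_law \<Omega> q \<rho> (distr Q borel Y)"
      using \<rho> LqU[of X] LqU[of Y] XY l by (auto simp: val convex_risk_measure_def)
  qed
qed

section \<open>Convex analysis\<close>

text \<open>Let \<open>c\<close> be in the relative interior of a simplex \<open>convex hull B\<close> in \<open>S\<close> with the same affine
  hull. On the simplex, \<open>f\<close> is bounded above by its values at the vertices. Reflecting a point \<open>x\<close>
  of \<open>S\<close> through \<open>c\<close>, scaled down, gives a point \<open>y\<close> of the simplex, and convexity on the segment
  from \<open>x\<close> through \<open>c\<close> to \<open>y\<close> bounds \<open>f x\<close> from below in terms of \<open>f c\<close> and the bound on \<open>f y\<close>.\<close>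

lemma convex_on_bounded_imp_bdd_below:
  fixes f :: "'a :: euclidean_space \<Rightarrow> real"
  assumes f: "convex_on S f" and S: "bounded S"
  shows "bdd_below (f ` S)"
proof (cases "S = {}")
  case False
  obtain B where B: "B \<subseteq> S" "\<not> affine_dependent B" "affine hull S = affine hull B"
    using affine_basis_exists[of S] by blast
  have fin: "finite B" using B(2) aff_independent_finite by blast
  have hull: "convex hull B \<subseteq> S"
    using B(1) f by (intro hull_minimal) (auto simp: convex_on_def)
  have "convex hull B \<noteq> {}"
    using B(3) False by auto
  then have "rel_interior (convex hull B) \<noteq> {}"
    by (simp add: rel_interior_eq_empty)
  then obtain c e where c: "c \<in> convex hull B" and e: "0 < e"
    and ball: "cball c e \<inter> affine hull B \<subseteq> convex hull B"
    by (auto simp: mem_rel_interior_cball)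
  have upper: "f y \<le> Max (f ` B)" if "y \<in> convex hull B" for y
    using convex_on_convex_hull_bound[of B f "Max (f ` B)"] that fin
      convex_on_subset[OF f hull] by auto
  obtain D where D: "0 < D" "\<And>x. x \<in> S \<Longrightarrow> norm (x - c) \<le> D"
  proof -
    obtain K where "\<forall>x\<in>S. dist c x \<le> K"
      using bounded_any_center[of S c] S by blast
    then show ?thesis
      by (intro that[of "\<bar>K\<bar> + 1"]) (force simp: dist_norm norm_minus_commute)+
  qed
  (* The scaling keeps the reflections of all points of S within distance e of c. *)
  define d where "d = e / D"
  have d: "0 < d" using e D by (simp add: d_def)
  have "((1 + d) * f c - Max (f ` B)) / d \<le> f x" if x: "x \<in> S" for x
  proof -
    define y where "y = c + d *\<^sub>R (c - x)"
    have "norm (c - y) = d * norm (x - c)"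
      using d by (simp add: y_def norm_minus_commute)
    also have "\<dots> \<le> d * D"
      using D(2)[OF x] d by (intro mult_left_mono) auto
    also have "\<dots> = e"
      using D(1) by (simp add: d_def)
    finally have "norm (c - y) \<le> e" .
    moreover have "y \<in> affine hull B"
    proof -
      have "x \<in> affine hull B" "c \<in> affine hull B"
        using x c hull B(3) hull_inc by (metis, metis hull_inc subsetD)
      then have "(1 + d) *\<^sub>R c + (- d) *\<^sub>R x \<in> affine hull B"
        by (intro mem_affine) auto
      then show ?thesis by (simp add: y_def algebra_simps)
    qed
    ultimately have y: "y \<in> convex hull B"
      using ball by (auto simp: dist_norm)
    have "c = (d / (1 + d)) *\<^sub>R x + (1 / (1 + d)) *\<^sub>R y"
    proof -
      have "(1 / (1 + d)) *\<^sub>R y = c - (d / (1 + d)) *\<^sub>R x"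
      proof -
        have "(1 / (1 + d)) *\<^sub>R y = (1 / (1 + d)) *\<^sub>R ((1 + d) *\<^sub>R c - d *\<^sub>R x)"
          by (simp add: y_def algebra_simps)
        also have "\<dots> = c - (d / (1 + d)) *\<^sub>R x"
          using d by (simp add: scaleR_diff_right)
        finally show ?thesis .
      qed
      then show ?thesis by simp
    qed
    moreover have "f ((d / (1 + d)) *\<^sub>R x + (1 / (1 + d)) *\<^sub>R y)
        \<le> d / (1 + d) * f x + 1 / (1 + d) * f y"
    proof -
      have "1 - 1 / (1 + d) = d / (1 + d)" using d by (simp add: field_simps)
      then show ?thesis
        using convex_onD[OF f, of "1 / (1 + d)" x y] x y hull d by auto
    qed
    ultimately have "f c \<le> d / (1 + d) * f x + 1 / (1 + d) * f y"
      by metis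
    also have "\<dots> = (d * f x + f y) / (1 + d)"
      by (simp add: add_divide_distrib)
    finally have "(1 + d) * f c \<le> d * f x + f y"
      using d by (simp add: field_simps)
    then show ?thesis using d upper[OF y] by (simp add: field_simps)
  qed
  then show ?thesis by (auto simp: bdd_below_def)
qed simp

text \<open>Near-minimal actions at \<open>x\<close> and at \<open>y\<close> combine to an action that is admissible at the convex
  combination of \<open>x\<close> and \<open>y\<close>; this is where convexity jointly in both variables is needed.\<close>

lemma convex_on_INF:
  fixes F :: "'s :: real_vector \<Rightarrow> 'a :: real_vector \<Rightarrow> real"
  assumes F: "convex_on (S \<times> A) (\<lambda>(s, a). F s a)" and "A \<noteq> {}"
    and bdd: "\<And>s. s \<in> S \<Longrightarrow> bdd_below (F s ` A)"
  shows "convex_on S (\<lambda>s. INF a\<in>A. F s a)"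
proof -
  have SA: "convex (S \<times> A)" using F by (simp add: convex_on_def)
  have S: "convex S"
    using convex_linear_image[OF linear_fst SA] \<open>A \<noteq> {}\<close> by (simp add: fst_image_times)
  have "(INF a\<in>A. F (u *\<^sub>R x + v *\<^sub>R y) a) \<le> u * (INF a\<in>A. F x a) + v * (INF a\<in>A. F y a)"
    if x: "x \<in> S" and y: "y \<in> S" and uv: "0 \<le> u" "0 \<le> v" "u + v = 1" for x y u v
  proof (rule field_le_epsilon)
    fix e :: real assume e: "0 < e"
    obtain a where a: "a \<in> A" "F x a < (INF a\<in>A. F x a) + e"
      using cInf_lessD[of "F x ` A" "(INF a\<in>A. F x a) + e"] \<open>A \<noteq> {}\<close> e by auto
    obtain b where b: "b \<in> A" "F y b < (INF a\<in>A. F y a) + e"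
      using cInf_lessD[of "F y ` A" "(INF a\<in>A. F y a) + e"] \<open>A \<noteq> {}\<close> e by auto
    have mem: "u *\<^sub>R (x, a) + v *\<^sub>R (y, b) \<in> S \<times> A"
      using SA x y a b uv by (intro convexD) auto
    have "(INF a\<in>A. F (u *\<^sub>R x + v *\<^sub>R y) a) \<le> F (u *\<^sub>R x + v *\<^sub>R y) (u *\<^sub>R a + v *\<^sub>R b)"
      using mem by (intro cINF_lower bdd) auto
    also have "\<dots> \<le> u * F x a + v * F y b"
      using F x y a b uv unfolding convex_on_def by fastforce
    also have "\<dots> \<le> u * ((INF a\<in>A. F x a) + e) + v * ((INF a\<in>A. F y a) + e)"
      using a b uv by (intro add_mono mult_left_mono) auto
    also have "\<dots> = u * (INF a\<in>A. F x a) + v * (INF a\<in>A. F y a) + (u + v) * e"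
      by (simp add: algebra_simps)
    finally show "(INF a\<in>A. F (u *\<^sub>R x + v *\<^sub>R y) a)
        \<le> u * (INF a\<in>A. F x a) + v * (INF a\<in>A. F y a) + e"
      using uv by simp
  qed
  with S show ?thesis by (simp add: convex_on_def)
qed

lemma INF_le_INF_add:
  fixes f g :: "'a \<Rightarrow> real"
  assumes "A \<noteq> {}" "bdd_below (f ` A)" "\<And>a. a \<in> A \<Longrightarrow> f a \<le> g a + c"
  shows "(INF a\<in>A. f a) \<le> (INF a\<in>A. g a) + c"
proof -
  have "(INF a\<in>A. f a) - c \<le> (INF a\<in>A. g a)"
  proof (rule cINF_greatest[OF assms(1)])
    fix a assume "a \<in> A"
    then show "(INF a\<in>A. f a) - c \<le> g a"
      using cINF_lower[OF assms(2), of a] assms(3)[of a] by simp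
  qed
  then show ?thesis by simp
qed

lemma convex_on_compose_order_convex:
  fixes g :: "'x :: real_vector \<Rightarrow> 'y :: ordered_real_vector"
  assumes g: "order_convex_on X g" and gS: "g ` X \<subseteq> S"
    and f: "convex_on S f" and mono: "mono_on S f"
  shows "convex_on X (\<lambda>x. f (g x))"
proof -
  have X: "convex X" using g by (simp add: order_convex_on_def)
  have "f (g (u *\<^sub>R x + v *\<^sub>R y)) \<le> u * f (g x) + v * f (g y)"
    if x: "x \<in> X" and y: "y \<in> X" and uv: "0 \<le> u" "0 \<le> v" "u + v = 1" for x y u v
  proof -
    have "u *\<^sub>R x + v *\<^sub>R y \<in> X" using X x y uv by (intro convexD)
    moreover have "u *\<^sub>R g x + v *\<^sub>R g y \<in> S"
      using f gS x y uv by (intro convexD) (auto simp: convex_on_def)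
    moreover have "g (u *\<^sub>R x + v *\<^sub>R y) \<le> u *\<^sub>R g x + v *\<^sub>R g y"
      using g x y uv by (simp add: order_convex_on_def)
    ultimately have "f (g (u *\<^sub>R x + v *\<^sub>R y)) \<le> f (u *\<^sub>R g x + v *\<^sub>R g y)"
      using gS by (intro mono_onD[OF mono]) auto
    also have "\<dots> \<le> u * f (g x) + v * f (g y)"
      using f image_subset_iff[THEN iffD1, OF gS] x y uv unfolding convex_on_def by blast
    finally show ?thesis .
  qed
  with X show ?thesis by (simp add: convex_on_def)
qed

lemma lipschitz_add_scaled_compose:
  fixes c :: "'x :: metric_space \<Rightarrow> real" and g :: "'x \<Rightarrow> 'y :: metric_space" and v :: "'y \<Rightarrow> real"
  assumes c: "C-lipschitz_on X c" and g: "G-lipschitz_on X g" and gS: "g ` X \<subseteq> S"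
    and v: "L-lipschitz_on S v" and \<gamma>: "0 \<le> \<gamma>"
  shows "(C + \<gamma> * L * G)-lipschitz_on X (\<lambda>x. c x + \<gamma> * v (g x))"
proof -
  have "(L * G)-lipschitz_on X (\<lambda>x. v (g x))"
    by (rule lipschitz_on_compose2[OF g lipschitz_on_subset[OF v gS]])
  then have "(\<bar>\<gamma>\<bar> * (L * G))-lipschitz_on X (\<lambda>x. \<gamma> * v (g x))"
    by (rule lipschitz_on_cmult_real)
  with c have "(C + \<bar>\<gamma>\<bar> * (L * G))-lipschitz_on X (\<lambda>x. c x + \<gamma> * v (g x))"
    by (rule lipschitz_on_add)
  then show ?thesis using \<gamma> by (simp add: mult.assoc)
qed

section \<open>The composite risk measure\<close>

lemma convex_risk_measure_inner_val:
  fixes M :: "('w, 's :: ordered_euclidean_space, 'a :: euclidean_space) bcr"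
  assumes model: "bcr_model M" and t: "t \<in> {1..horizon M}" and \<theta>: "\<theta> \<in> params M"
    and inner: "convex_risk_measure (base M) (inner_exp M) (inner_rm M t)"
  shows "convex_risk_measure (obs_law M \<theta>) (inner_exp M) (\<lambda>Z. inner_val M t Z \<theta>)"
  unfolding inner_val_def
proof (rule convex_risk_measure_at_law[OF inner, where S = "noise M"])
  show "sets (obs_law M \<theta>) = sets (restrict_space borel (noise M))"
    by (simp add: obs_law_def sets_restrict_space)
qed (use model t \<theta> in \<open>auto simp: bcr_model_def\<close>)

lemma prob_space_belief_law:
  assumes "\<mu> \<in> beliefs M"
  shows "prob_space (belief_law M \<mu>)"
proof (rule prob_space_distrD)
  show "(\<lambda>\<theta>. \<theta>) \<in> belief_law M \<mu> \<rightarrow>\<^sub>M borel"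
    by (simp add: belief_law_def measurable_restrict_space1)
  show "prob_space (distr (belief_law M \<mu>) borel (\<lambda>\<theta>. \<theta>))"
    using assms by (simp add: beliefs_def M1_def)
qed

lemma convex_risk_measure_outer:
  fixes M :: "('w, 's :: ordered_euclidean_space, 'a :: euclidean_space) bcr"
  assumes model: "bcr_model M" and t: "t \<in> {1..horizon M}" and \<mu>: "\<mu> \<in> beliefs M"
    and outer: "convex_risk_measure (base M) (outer_exp M) (outer_rm M t)"
  shows "convex_risk_measure (belief_law M \<mu>) (outer_exp M)
    (\<lambda>Y. at_law (base M) (outer_exp M) (outer_rm M t) (distr (belief_law M \<mu>) borel Y))"
proof (rule convex_risk_measure_at_law[OF outer, where S = "params M"])
  show "sets (belief_law M \<mu>) = sets (restrict_space borel (params M))"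
    by (simp add: belief_law_def sets_restrict_space)
qed (use model t prob_space_belief_law[OF \<mu>] in \<open>auto simp: bcr_model_def\<close>)

text \<open>The domain hypotheses concern the three costs themselves. The inner risk of the combination of
  \<open>Z\<close> and \<open>W\<close> is not known to be a measurable function of \<open>\<theta>\<close>, but the combination of their inner risks
  is, and it dominates the inner risk of \<open>V\<close>.\<close>

lemma composite_le:
  fixes M :: "('w, 's :: ordered_euclidean_space, 'a :: euclidean_space) bcr"
  assumes model: "bcr_model M" and t: "t \<in> {1..horizon M}" and \<mu>: "\<mu> \<in> beliefs M"
    and inner: "convex_risk_measure (base M) (inner_exp M) (inner_rm M t)"
    and outer: "convex_risk_measure (base M) (outer_exp M) (outer_rm M t)"
    and V: "composable M t \<mu> V" and Z: "composable M t \<mu> Z" and W: "composable M t \<mu> W"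
    and l: "l \<in> {0..1}"
    and le: "\<And>x. x \<in> noise M \<Longrightarrow> V x \<le> l * Z x + (1 - l) * W x + c"
  shows "composite M t \<mu> V \<le> l * composite M t \<mu> Z + (1 - l) * composite M t \<mu> W + c"
  unfolding composite_def
proof (rule convex_risk_measure_le[OF convex_risk_measure_outer[OF model t \<mu> outer]])
  fix \<theta> assume "\<theta> \<in> space (belief_law M \<mu>)"
  then have \<theta>: "\<theta> \<in> params M"
    by (simp add: belief_law_def space_restrict_space)
  show "inner_val M t V \<theta> \<le> l * inner_val M t Z \<theta> + (1 - l) * inner_val M t W \<theta> + c"
  proof (rule convex_risk_measure_le[OF convex_risk_measure_inner_val[OF model t \<theta> inner]])
    show "V x \<le> l * Z x + (1 - l) * W x + c" if "x \<in> space (obs_law M \<theta>)" for x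
      using that le by (simp add: obs_law_def space_restrict_space)
  qed (use model \<theta> V Z W l in \<open>auto simp: bcr_model_def composable_def\<close>)
qed (use model prob_space_belief_law[OF \<mu>] V Z W l in \<open>auto simp: bcr_model_def composable_def\<close>)

section \<open>Convexity and monotonicity of the value functions\<close>

text \<open>The conditions under which the backward induction runs. Boundedness of the action set makes the
  infima over actions finite. A parameter is required to exist because convexity of the domain
  and the signs of the Lipschitz moduli are read off at some observation.\<close>

locale convex_bcr =
  fixes M :: "('w, 's :: ordered_euclidean_space, 'a :: euclidean_space) bcr"
  assumes model: "bcr_model M"
    and well_defined: "value_fun_well_defined M"
    and bounded_actions: "bounded (actions M)"
    and cost_convex: "\<And>t x. t \<in> {1..horizon M - 1} \<Longrightarrow> x \<in> noise M \<Longrightarrow>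
      convex_on (states M \<times> actions M) (\<lambda>(s, a). cost M t s a x)"
    and final_cost_convex: "convex_on (states M) (final_cost M)"
    and trans_convex: "\<And>t x. t \<in> {1..horizon M - 1} \<Longrightarrow> x \<in> noise M \<Longrightarrow>
      order_convex_on (states M \<times> actions M) (\<lambda>(s, a). trans M t s a x)"
    and cost_mono: "\<And>t a x. t \<in> {1..horizon M - 1} \<Longrightarrow> a \<in> actions M \<Longrightarrow> x \<in> noise M \<Longrightarrow>
      mono_on (states M) (\<lambda>s. cost M t s a x)"
    and final_cost_mono: "mono_on (states M) (final_cost M)"
    and trans_mono: "\<And>t a x. t \<in> {1..horizon M - 1} \<Longrightarrow> a \<in> actions M \<Longrightarrow> x \<in> noise M \<Longrightarrow>
      mono_on (states M) (\<lambda>s. trans M t s a x)"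
    and inner_convex: "\<And>t. t \<in> {1..horizon M} \<Longrightarrow>
      convex_risk_measure (base M) (inner_exp M) (inner_rm M t)"
    and outer_convex: "\<And>t. t \<in> {1..horizon M} \<Longrightarrow>
      convex_risk_measure (base M) (outer_exp M) (outer_rm M t)"
    and params_nonempty: "params M \<noteq> {}"
begin

lemma disc_pos: "0 < disc M" and actions_nonempty: "actions M \<noteq> {}"
  using model by (auto simp: bcr_model_def)

lemma noise_nonempty: "noise M \<noteq> {}"
proof -
  obtain \<theta> where "\<theta> \<in> params M" using params_nonempty by auto
  then have "prob_space (obs_law M \<theta>)" using model by (simp add: bcr_model_def)
  then have "space (obs_law M \<theta>) \<noteq> {}" by (rule prob_space.not_empty)
  then show ?thesis by (auto simp: obs_law_def space_restrict_space)
qed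

lemma trans_in_states:
  "t \<in> {1..horizon M - 1} \<Longrightarrow> s \<in> states M \<Longrightarrow> a \<in> actions M \<Longrightarrow> x \<in> noise M \<Longrightarrow>
    trans M t s a x \<in> states M"
  using model by (simp add: bcr_model_def)

lemma convex_states_actions:
  assumes "t \<in> {1..horizon M - 1}"
  shows "convex (states M \<times> actions M)"
  using noise_nonempty cost_convex[OF assms] by (auto simp: convex_on_def)

lemma value_fun_off_beliefs:
  assumes "t < horizon M" "\<mu> \<notin> beliefs M"
  shows "value_fun M t s \<mu> = 0"
proof -
  obtain n where "horizon M - t = Suc n"
    using assms(1) by (metis zero_less_diff gr0_implies_Suc)
  then show ?thesis using assms(2) by (simp add: value_fun_def)
qed

lemma composite_stage_cost_le:
  assumes t: "t \<in> {1..horizon M - 1}" and \<mu>: "\<mu> \<in> beliefs M" and l: "l \<in> {0..1}"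
    and s: "s \<in> states M" "s1 \<in> states M" "s2 \<in> states M"
    and a: "a \<in> actions M" "a1 \<in> actions M" "a2 \<in> actions M"
    and le: "\<And>x. x \<in> noise M \<Longrightarrow>
      stage_cost M t s a \<mu> x \<le> l * stage_cost M t s1 a1 \<mu> x + (1 - l) * stage_cost M t s2 a2 \<mu> x + c"
  shows "composite M t \<mu> (stage_cost M t s a \<mu>)
    \<le> l * composite M t \<mu> (stage_cost M t s1 a1 \<mu>)
      + (1 - l) * composite M t \<mu> (stage_cost M t s2 a2 \<mu>) + c"
proof (rule composite_le[OF model _ \<mu> inner_convex outer_convex _ _ _ l le])
  show "t \<in> {1..horizon M}" "t \<in> {1..horizon M}" "t \<in> {1..horizon M}" using t by auto
qed (use well_defined t \<mu> s a in \<open>auto simp: value_fun_well_defined_def\<close>)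

lemma composite_stage_cost_le_add:
  assumes "t \<in> {1..horizon M - 1}" "\<mu> \<in> beliefs M"
    and "s1 \<in> states M" "s2 \<in> states M" "a \<in> actions M"
    and "\<And>x. x \<in> noise M \<Longrightarrow> stage_cost M t s1 a \<mu> x \<le> stage_cost M t s2 a \<mu> x + c"
  shows "composite M t \<mu> (stage_cost M t s1 a \<mu>) \<le> composite M t \<mu> (stage_cost M t s2 a \<mu>) + c"
  using composite_stage_cost_le[of t \<mu> 1 s1 s2 s2 a a a c] assms by simp

lemma convex_on_stage_cost:
  assumes t: "t \<in> {1..horizon M - 1}" and x: "x \<in> noise M"
    and conv: "convex_on (states M) (\<lambda>s. value_fun M (t + 1) s (bayes M \<mu> x))"
    and mono: "mono_on (states M) (\<lambda>s. value_fun M (t + 1) s (bayes M \<mu> x))"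
  shows "convex_on (states M \<times> actions M) (\<lambda>(s, a). stage_cost M t s a \<mu> x)"
proof -
  let ?g = "\<lambda>(s, a). trans M t s a x"
  have "convex_on (states M \<times> actions M) (\<lambda>z. value_fun M (t + 1) (?g z) (bayes M \<mu> x))"
    by (rule convex_on_compose_order_convex[OF trans_convex[OF t x] _ conv mono])
      (use trans_in_states t x in auto)
  then have "convex_on (states M \<times> actions M)
      (\<lambda>z. (case z of (s, a) \<Rightarrow> cost M t s a x) + disc M * value_fun M (t + 1) (?g z) (bayes M \<mu> x))"
    using disc_pos by (intro convex_on_add convex_on_cmul cost_convex t x) auto
  then show ?thesis
    by (simp add: stage_cost_def case_prod_unfold)
qed

lemma mono_on_stage_cost:
  assumes t: "t \<in> {1..horizon M - 1}" and x: "x \<in> noise M" and a: "a \<in> actions M"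
    and mono: "mono_on (states M) (\<lambda>s. value_fun M (t + 1) s (bayes M \<mu> x))"
  shows "mono_on (states M) (\<lambda>s. stage_cost M t s a \<mu> x)"
proof (rule mono_onI)
  fix r s assume rs: "r \<in> states M" "s \<in> states M" "r \<le> s"
  have "value_fun M (t + 1) (trans M t r a x) (bayes M \<mu> x)
      \<le> value_fun M (t + 1) (trans M t s a x) (bayes M \<mu> x)"
    using rs t x a by (intro mono_onD[OF mono] mono_onD[OF trans_mono] trans_in_states)
  then show "stage_cost M t r a \<mu> x \<le> stage_cost M t s a \<mu> x"
    unfolding stage_cost_def using rs t x a disc_pos
    by (intro add_mono mono_onD[OF cost_mono] mult_left_mono) auto
qed

text \<open>The hypotheses range over all \<open>\<nu>\<close>, since the Bayes update of \<open>\<mu>\<close> can fail to be a belief for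
  exceptional observations. There the value functions are constant before the final stage, and equal to
  the final cost at that stage, hence still convex and non-decreasing.\<close>

lemma convex_on_composite_stage_cost:
  assumes t: "t \<in> {1..horizon M - 1}" and \<mu>: "\<mu> \<in> beliefs M"
    and conv: "\<And>\<nu>. convex_on (states M) (\<lambda>s. value_fun M (t + 1) s \<nu>)"
    and mono: "\<And>\<nu>. mono_on (states M) (\<lambda>s. value_fun M (t + 1) s \<nu>)"
  shows "convex_on (states M \<times> actions M) (\<lambda>(s, a). composite M t \<mu> (stage_cost M t s a \<mu>))"
  unfolding convex_on_def
proof (intro conjI ballI allI impI)
  show SA: "convex (states M \<times> actions M)" using t by (rule convex_states_actions)
  fix z1 z2 and u v :: real
  assume z: "z1 \<in> states M \<times> actions M" "z2 \<in> states M \<times> actions M"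
    and uv: "0 \<le> u" "0 \<le> v" "u + v = 1"
  obtain s1 a1 s2 a2 where z12: "z1 = (s1, a1)" "z2 = (s2, a2)" by (cases z1, cases z2)
  have v: "v = 1 - u" using uv by simp
  let ?s = "u *\<^sub>R s1 + v *\<^sub>R s2" and ?a = "u *\<^sub>R a1 + v *\<^sub>R a2"
  have mem: "(?s, ?a) \<in> states M \<times> actions M"
    using convexD[OF SA z uv] by (simp add: z12)
  have "composite M t \<mu> (stage_cost M t ?s ?a \<mu>) \<le> u * composite M t \<mu> (stage_cost M t s1 a1 \<mu>)
      + (1 - u) * composite M t \<mu> (stage_cost M t s2 a2 \<mu>) + 0"
  proof (rule composite_stage_cost_le[OF t \<mu>])
    fix x assume "x \<in> noise M"
    from convex_on_stage_cost[OF t this conv mono, of \<mu>]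
    show "stage_cost M t ?s ?a \<mu> x
        \<le> u * stage_cost M t s1 a1 \<mu> x + (1 - u) * stage_cost M t s2 a2 \<mu> x + 0"
      using z uv unfolding convex_on_def v[symmetric] z12 by fastforce
  qed (use mem z uv z12 in auto)
  then show "(case u *\<^sub>R z1 + v *\<^sub>R z2 of (s, a) \<Rightarrow> composite M t \<mu> (stage_cost M t s a \<mu>))
      \<le> u * (case z1 of (s, a) \<Rightarrow> composite M t \<mu> (stage_cost M t s a \<mu>))
        + v * (case z2 of (s, a) \<Rightarrow> composite M t \<mu> (stage_cost M t s a \<mu>))"
    by (simp add: z12 v)
qed

lemma convex_on_actions:
  assumes F: "convex_on (states M \<times> actions M) (\<lambda>(s, a). F s a)" and s: "s \<in> states M"
  shows "convex_on (actions M) (F s)"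
proof -
  have SA: "convex (states M \<times> actions M)" using F by (simp add: convex_on_def)
  have A: "convex (actions M)"
    using convex_linear_image[OF linear_snd SA] s by (auto simp: snd_image_times split: if_splits)
  have "F s (u *\<^sub>R a + v *\<^sub>R b) \<le> u * F s a + v * F s b"
    if "a \<in> actions M" "b \<in> actions M" "0 \<le> u" "0 \<le> v" "u + v = 1" for a b u v
  proof -
    have "u *\<^sub>R s + v *\<^sub>R s = s" using that by (simp flip: scaleR_add_left)
    then show ?thesis
      using F s that unfolding convex_on_def by fastforce
  qed
  with A show ?thesis by (simp add: convex_on_def)
qed

lemma value_fun_step:
  assumes t: "t \<in> {1..horizon M - 1}"
    and conv: "\<And>\<nu>. convex_on (states M) (\<lambda>s. value_fun M (t + 1) s \<nu>)"
    and mono: "\<And>\<nu>. mono_on (states M) (\<lambda>s. value_fun M (t + 1) s \<nu>)"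
  shows "convex_on (states M) (\<lambda>s. value_fun M t s \<mu>) \<and> mono_on (states M) (\<lambda>s. value_fun M t s \<mu>)"
proof (cases "\<mu> \<in> beliefs M")
  case True
  have tT: "t < horizon M" using t by auto
  let ?F = "\<lambda>s a. composite M t \<mu> (stage_cost M t s a \<mu>)"
  have F: "convex_on (states M \<times> actions M) (\<lambda>(s, a). ?F s a)"
    by (rule convex_on_composite_stage_cost[OF t True conv mono])
  have bdd: "bdd_below (?F s ` actions M)" if "s \<in> states M" for s
    by (rule convex_on_bounded_imp_bdd_below[OF convex_on_actions[OF F that] bounded_actions])
  have "mono_on (states M) (\<lambda>s. INF a\<in>actions M. ?F s a)"
  proof (rule mono_onI)
    fix r s assume rs: "r \<in> states M" "s \<in> states M" "r \<le> s"
    have "?F r a \<le> ?F s a + 0" if "a \<in> actions M" for a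
      using rs that mono_onD[OF mono_on_stage_cost[OF t _ that mono] rs]
      by (intro composite_stage_cost_le_add[OF t True]) auto
    then show "(INF a\<in>actions M. ?F r a) \<le> (INF a\<in>actions M. ?F s a)"
      using INF_le_INF_add[OF actions_nonempty bdd[OF rs(1)], of "?F s" 0] by simp
  qed
  with convex_on_INF[OF F actions_nonempty bdd] show ?thesis
    by (simp add: value_fun_bellman[OF tT True])
next
  case False
  have "convex (states M)" using final_cost_convex by (simp add: convex_on_def)
  moreover have "value_fun M t s \<mu> = 0" for s
    using t by (intro value_fun_off_beliefs False) auto
  ultimately show ?thesis
    by (simp add: convex_on_const mono_on_def)
qed

lemma value_fun_convex_mono:
  assumes "t \<in> {1..horizon M}"
  shows "convex_on (states M) (\<lambda>s. value_fun M t s \<mu>) \<and> mono_on (states M) (\<lambda>s. value_fun M t s \<mu>)"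
proof -
  have "t \<le> horizon M" "1 \<le> t" using assms by auto
  then show ?thesis
  proof (induction arbitrary: \<mu> rule: inc_induct)
    case base
    then show ?case
      using final_cost_convex final_cost_mono by (simp add: value_fun_final)
  next
    case (step t)
    then show ?case by (intro value_fun_step) auto
  qed
qed

lemma composite_stage_cost_convex:
  assumes "t \<in> {1..horizon M - 1}" "\<mu> \<in> beliefs M"
  shows "convex_on (states M \<times> actions M) (\<lambda>(s, a). composite M t \<mu> (stage_cost M t s a \<mu>))"
  using assms value_fun_convex_mono[of "t + 1"]
  by (intro convex_on_composite_stage_cost) auto

lemma composite_stage_cost_convex_action:
  assumes "t \<in> {1..horizon M - 1}" "\<mu> \<in> beliefs M" "s \<in> states M"
  shows "convex_on (actions M) (\<lambda>a. composite M t \<mu> (stage_cost M t s a \<mu>))"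
  by (rule convex_on_actions[OF composite_stage_cost_convex[OF assms(1,2)] assms(3)])

section \<open>Lipschitz continuity of the value functions\<close>

lemma value_lipschitz_const_step:
  assumes "t < horizon M"
  shows "value_lipschitz_const M LC Lg t = LC + disc M * value_lipschitz_const M LC Lg (t + 1) * Lg"
proof -
  obtain n where n: "horizon M - t = Suc n" "horizon M - (t + 1) = n"
    using assms by (metis Suc_diff_Suc Suc_eq_plus1)
  show ?thesis
    unfolding value_lipschitz_const_def n sum.atLeast0_atMost_Suc_shift
    by (simp add: sum_distrib_left sum_distrib_right mult_ac)
qed

text \<open>Swapping the two states turns the one-sided bound \<open>le\<close> into the Lipschitz estimate. The lower
  bound required by the infima is the one that convexity provides.\<close>

lemma value_fun_lipschitz:
  assumes lip: "\<And>t a x. t \<in> {1..horizon M - 1} \<Longrightarrow> a \<in> actions M \<Longrightarrow> x \<in> noise M \<Longrightarrow>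
      LC-lipschitz_on (states M) (\<lambda>s. cost M t s a x) \<and> Lg-lipschitz_on (states M) (\<lambda>s. trans M t s a x)"
    and final: "LC-lipschitz_on (states M) (final_cost M)"
    and t: "t \<in> {1..horizon M}"
  shows "(value_lipschitz_const M LC Lg t)-lipschitz_on (states M) (\<lambda>s. value_fun M t s \<mu>)"
proof -
  have "t \<le> horizon M" "1 \<le> t" using t by auto
  then show ?thesis
  proof (induction arbitrary: \<mu> rule: inc_induct)
    case base
    then show ?case
      using final by (simp add: value_fun_final value_lipschitz_const_def)
  next
    case (step t)
    let ?L = "value_lipschitz_const M LC Lg (t + 1)"
    let ?K = "LC + disc M * ?L * Lg"
    have tT: "t < horizon M" and t: "t \<in> {1..horizon M - 1}" using step by auto
    have v: "?L-lipschitz_on (states M) (\<lambda>s. value_fun M (t + 1) s \<nu>)" for \<nu>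
      using step.IH[of \<nu>] by simp
    obtain a x where "a \<in> actions M" "x \<in> noise M"
      using actions_nonempty noise_nonempty by blast
    then have "0 \<le> Lg" using lip[OF t] lipschitz_on_nonneg by blast
    then have K: "0 \<le> ?K"
      using lipschitz_on_nonneg[OF v] lipschitz_on_nonneg[OF final] disc_pos by simp
    have "?K-lipschitz_on (states M) (\<lambda>s. value_fun M t s \<mu>)"
    proof (cases "\<mu> \<in> beliefs M")
      case True
      let ?F = "\<lambda>s a. composite M t \<mu> (stage_cost M t s a \<mu>)"
      have le: "value_fun M t r \<mu> \<le> value_fun M t s \<mu> + ?K * norm (r - s)"
        if rs: "r \<in> states M" "s \<in> states M" for r s
        unfolding value_fun_bellman[OF tT True]
      proof (rule INF_le_INF_add[OF actions_nonempty])
        show "bdd_below (?F r ` actions M)"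
          by (rule convex_on_bounded_imp_bdd_below
              [OF composite_stage_cost_convex_action[OF t True rs(1)] bounded_actions])
        fix a assume a: "a \<in> actions M"
        show "?F r a \<le> ?F s a + ?K * norm (r - s)"
        proof (rule composite_stage_cost_le_add[OF t True rs a])
          fix x assume x: "x \<in> noise M"
          have "?K-lipschitz_on (states M) (\<lambda>s. stage_cost M t s a \<mu> x)"
            unfolding stage_cost_def
            by (rule lipschitz_add_scaled_compose[OF _ _ _ v])
              (use lip[OF t a x] trans_in_states[OF t _ a x] disc_pos in auto)
          from lipschitz_on_normD[OF this rs]
          show "stage_cost M t r a \<mu> x \<le> stage_cost M t s a \<mu> x + ?K * norm (r - s)"
            by simp
        qed
      qed
      show ?thesis
      proof (rule lipschitz_onI[OF _ K])
        fix r s assume "r \<in> states M" "s \<in> states M"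
        then show "dist (value_fun M t r \<mu>) (value_fun M t s \<mu>) \<le> ?K * dist r s"
          using le[of r s] le[of s r]
          by (simp add: dist_norm abs_le_iff norm_minus_commute)
      qed
    next
      case False
      then show ?thesis
        using K tT by (auto intro: lipschitz_onI simp: value_fun_off_beliefs)
    qed
    then show ?case by (simp only: value_lipschitz_const_step[OF tT])
  qed
qed

end

theorem proposition4:
  fixes M :: "('w, 's :: ordered_euclidean_space, 'a :: euclidean_space) bcr"
    and \<kappa>\<^sub>C \<xi>\<^sub>0 \<theta>\<^sub>c :: real and \<kappa>\<^sub>\<rho> :: "nat \<Rightarrow> real" and \<mu>\<^sub>1 :: "real \<Rightarrow> real"
    and N :: "'v measure" and \<xi> :: "nat \<Rightarrow> 'v \<Rightarrow> real"
  assumes model: "bcr_model M"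
    and well_defined: "value_fun_well_defined M"
    and A: "assumption_A M \<kappa>\<^sub>C \<kappa>\<^sub>\<rho> \<xi>\<^sub>0 \<mu>\<^sub>1 N \<xi> \<theta>\<^sub>c"
    and cost_convex: "\<And>t x. t \<in> {1..horizon M - 1} \<Longrightarrow> x \<in> noise M \<Longrightarrow>
      convex_on (states M \<times> actions M) (\<lambda>(s, a). cost M t s a x)"
    and final_cost_convex: "convex_on (states M) (final_cost M)"
    and trans_convex: "\<And>t x. t \<in> {1..horizon M - 1} \<Longrightarrow> x \<in> noise M \<Longrightarrow>
      order_convex_on (states M \<times> actions M) (\<lambda>(s, a). trans M t s a x)"
    and cost_mono: "\<And>t a x. t \<in> {1..horizon M - 1} \<Longrightarrow> a \<in> actions M \<Longrightarrow> x \<in> noise M \<Longrightarrow>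
      mono_on (states M) (\<lambda>s. cost M t s a x)"
    and final_cost_mono: "mono_on (states M) (final_cost M)"
    and trans_mono: "\<And>t a x. t \<in> {1..horizon M - 1} \<Longrightarrow> a \<in> actions M \<Longrightarrow> x \<in> noise M \<Longrightarrow>
      mono_on (states M) (\<lambda>s. trans M t s a x)"
    and inner_convex: "\<And>t. t \<in> {1..horizon M} \<Longrightarrow>
      convex_risk_measure (base M) (inner_exp M) (inner_rm M t)"
    and outer_convex: "\<And>t. t \<in> {1..horizon M} \<Longrightarrow>
      convex_risk_measure (base M) (outer_exp M) (outer_rm M t)"
  shows
    "(\<forall>t\<in>{1..horizon M - 1}. \<forall>s\<in>states M. \<forall>\<mu>\<in>beliefs M.
        convex_on (actions M) (\<lambda>a. composite M t \<mu> (stage_cost M t s a \<mu>)))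
   \<and> (\<forall>L\<^sub>C L\<^sub>g.
        (\<forall>t\<in>{1..horizon M - 1}. \<forall>a\<in>actions M. \<forall>x\<in>noise M.
           L\<^sub>C-lipschitz_on (states M) (\<lambda>s. cost M t s a x) \<and>
           L\<^sub>g-lipschitz_on (states M) (\<lambda>s. trans M t s a x)) \<and>
        L\<^sub>C-lipschitz_on (states M) (final_cost M)
        \<longrightarrow>
        (\<forall>t\<in>{1..horizon M - 1}. \<forall>\<mu>\<in>beliefs M. \<forall>s1\<in>states M. \<forall>s2\<in>states M.
           \<bar>value_fun M t s2 \<mu> - value_fun M t s1 \<mu>\<bar>
             \<le> (L\<^sub>C + disc M * value_lipschitz_const M L\<^sub>C L\<^sub>g (t + 1) * L\<^sub>g) * norm (s1 - s2)) \<and>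
        ((\<forall>t\<in>{1..horizon M - 1}. \<forall>s\<in>states M. \<forall>x\<in>noise M.
            L\<^sub>C-lipschitz_on (actions M) (\<lambda>a. cost M t s a x) \<and>
            L\<^sub>g-lipschitz_on (actions M) (\<lambda>a. trans M t s a x))
         \<longrightarrow>
         (\<forall>t\<in>{1..horizon M - 1}. \<forall>s\<in>states M. \<forall>\<mu>\<in>beliefs M. \<forall>x\<in>noise M.
            \<forall>a1\<in>actions M. \<forall>a2\<in>actions M.
            \<bar>cost M t s a1 x + disc M * value_fun M (t + 1) (trans M t s a1 x) (bayes M \<mu> x)
              - cost M t s a2 x - disc M * value_fun M (t + 1) (trans M t s a2 x) (bayes M \<mu> x)\<bar>
              \<le> (L\<^sub>C + disc M * value_lipschitz_const M L\<^sub>C L\<^sub>g (t + 1) * L\<^sub>g) * norm (a1 - a2))))"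
proof -
  interpret convex_bcr M
  proof
    show "bounded (actions M)" "params M \<noteq> {}"
      using A by (auto simp: assumption_A_def observations_iid_def compact_imp_bounded)
  qed (fact assms)+
  show ?thesis
  proof (intro conjI ballI allI impI; (elim conjE)?)
    fix t s \<mu>
    assume "t \<in> {1..horizon M - 1}" "s \<in> states M" "\<mu> \<in> beliefs M"
    then show "convex_on (actions M) (\<lambda>a. composite M t \<mu> (stage_cost M t s a \<mu>))"
      by (intro composite_stage_cost_convex_action)
  next
    fix L\<^sub>C L\<^sub>g t \<mu> s1 s2
    assume lip: "\<forall>t\<in>{1..horizon M - 1}. \<forall>a\<in>actions M. \<forall>x\<in>noise M.
           L\<^sub>C-lipschitz_on (states M) (\<lambda>s. cost M t s a x) \<and>
           L\<^sub>g-lipschitz_on (states M) (\<lambda>s. trans M t s a x)"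
      and final: "L\<^sub>C-lipschitz_on (states M) (final_cost M)"
      and t: "t \<in> {1..horizon M - 1}" and s: "s1 \<in> states M" "s2 \<in> states M"
    have "(value_lipschitz_const M L\<^sub>C L\<^sub>g t)-lipschitz_on (states M) (\<lambda>s. value_fun M t s \<mu>)"
      using lip final t by (intro value_fun_lipschitz) auto
    from lipschitz_on_normD[OF this s(2,1)]
    show "\<bar>value_fun M t s2 \<mu> - value_fun M t s1 \<mu>\<bar>
        \<le> (L\<^sub>C + disc M * value_lipschitz_const M L\<^sub>C L\<^sub>g (t + 1) * L\<^sub>g) * norm (s1 - s2)"
      using t value_lipschitz_const_step[of t L\<^sub>C L\<^sub>g] by (auto simp: norm_minus_commute)
  next
    fix L\<^sub>C L\<^sub>g t s \<mu> x a1 a2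
    assume lip: "\<forall>t\<in>{1..horizon M - 1}. \<forall>a\<in>actions M. \<forall>x\<in>noise M.
           L\<^sub>C-lipschitz_on (states M) (\<lambda>s. cost M t s a x) \<and>
           L\<^sub>g-lipschitz_on (states M) (\<lambda>s. trans M t s a x)"
      and final: "L\<^sub>C-lipschitz_on (states M) (final_cost M)"
      and lip_a: "\<forall>t\<in>{1..horizon M - 1}. \<forall>s\<in>states M. \<forall>x\<in>noise M.
            L\<^sub>C-lipschitz_on (actions M) (\<lambda>a. cost M t s a x) \<and>
            L\<^sub>g-lipschitz_on (actions M) (\<lambda>a. trans M t s a x)"
      and t: "t \<in> {1..horizon M - 1}" and s: "s \<in> states M" and x: "x \<in> noise M"
      and a: "a1 \<in> actions M" "a2 \<in> actions M"
    have v: "(value_lipschitz_const M L\<^sub>C L\<^sub>g (t + 1))-lipschitz_on (states M)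
        (\<lambda>s. value_fun M (t + 1) s (bayes M \<mu> x))"
      using lip final t by (intro value_fun_lipschitz) auto
    have "(L\<^sub>C + disc M * value_lipschitz_const M L\<^sub>C L\<^sub>g (t + 1) * L\<^sub>g)-lipschitz_on (actions M)
        (\<lambda>a. cost M t s a x + disc M * value_fun M (t + 1) (trans M t s a x) (bayes M \<mu> x))"
      by (rule lipschitz_add_scaled_compose[OF _ _ _ v])
        (use lip_a t s x trans_in_states[OF t s _ x] disc_pos in auto)
    from lipschitz_on_normD[OF this a]
    show "\<bar>cost M t s a1 x + disc M * value_fun M (t + 1) (trans M t s a1 x) (bayes M \<mu> x)
        - cost M t s a2 x - disc M * value_fun M (t + 1) (trans M t s a2 x) (bayes M \<mu> x)\<bar>
        \<le> (L\<^sub>C + disc M * value_lipschitz_const M L\<^sub>C L\<^sub>g (t + 1) * L\<^sub>g) * norm (a1 - a2)"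
      by (simp add: algebra_simps)
  qed
qed

end
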